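(* Let $\alpha\in(0,1)$. For each $n$ let $(x_i,y_i)_{i=1}^n$ be independent copies of $(x,y)$ with $y=f(x)+\epsilon$, where $x$ takes values in $\mathscr X$, $\mathbb E[f(x)]=0$, $\mathbb E[f^2(x)]=\sigma_\mu^2$, $\mathbb E[f^4(x)]<\infty$, $\mathbb E(\epsilon)=0$, $\mathbb E(\epsilon^2)=\sigma_\epsilon^2$, and $\epsilon$ is independent of $x$. Suppose that for a fixed $\delta>0$ there are an estimator $\hat f:\mathscr X\times(\mathscr X\times\mathbb R)^n\times\Pi_n\to\mathbb R$ and a sequence $\ell_n$ (possibly depending on $\delta$) such that (i) for all $\pi\in\Pi_n$, $\hat f(x_i;(x_j,y_j)_{j=1}^n;\pi)=\hat f(x_i;(x_j,y_{\pi(j)})_{j=1}^n;\pi_0)$; (ii) for all $n$ sufficiently large, $\min_{\pi\in\tilde\Pi_n\cup\{\pi_0\}}\mathbb P\big\{\sum_{i=1}^n[\hat f(x_i;(x_j,y_j)_{j=1}^n;\pi)-f_\pi(x_i)]^2\le\ell_n\big\}\ge1-\delta$. Then, under the null hypothesis $H_0:f\equiv0$, $$\limsup_{n\to\infty}\mathbb P_{H_0}(\phi(\hat f)\le\alpha)\le\alpha.$$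
   Context: $\Pi_n$ is the set of all permutations of $[n]=\{1,\dots,n\}$, $\pi_0$ is the identity permutation, $K(\pi)$ is the number of cycles of $\pi$ (fixed points count as cycles), and $\tilde\Pi_n=\{\pi\in\Pi_n:K(\pi)\le\log^2(n)\}$. For $\pi\in\Pi_n$, $f_\pi(x_i):=\mathbb E(y_{\pi(i)}\mid x_i)$ (so $f_\pi(x_i)=f(x_i)$ if $\pi(i)=i$ and $f_\pi(x_i)=0$ otherwise). Set $\hat f_\pi(\cdot)=\hat f(\cdot;(x_j,y_j)_{j=1}^n;\pi)$ and $\Lambda^{(\pi)}(\hat f)=\sum_{i=1}^n[\hat f_\pi(x_i)]^2$. The permutation p-value is $\phi(\hat f)=\frac1{|\Pi_n|}\sum_{\pi\in\Pi_n}\mathbf 1\{\Lambda^{(\pi_0)}(\hat f)\le\Lambda^{(\pi)}(\hat f)\}$. *)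

theory Defs
  imports "HOL-Probability.Probability" "HOL-Combinatorics.Orbits"
begin

definition perms :: "nat \<Rightarrow> (nat \<Rightarrow> nat) set" where
  "perms n = {\<pi>. \<pi> permutes {1..n}}"

text \<open>A fixed point \<open>i\<close> has \<open>orbit \<pi> i = {i}\<close>, so it is counted as a cycle.\<close>

definition num_cycles :: "nat \<Rightarrow> (nat \<Rightarrow> nat) \<Rightarrow> nat" where
  "num_cycles n \<pi> = card (orbit \<pi> ` {1..n})"

definition few_cycle_perms :: "nat \<Rightarrow> (nat \<Rightarrow> nat) set" where
  "few_cycle_perms n = {\<pi> \<in> perms n. real (num_cycles n \<pi>) \<le> (ln (real n))\<^sup>2}"

text \<open>A data set of size \<open>n\<close> is an element of the product over the index set \<open>{1..n}\<close>.\<close>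

definition sample :: "nat \<Rightarrow> (nat \<Rightarrow> 'x) \<Rightarrow> (nat \<Rightarrow> real) \<Rightarrow> nat \<Rightarrow> 'x \<times> real" where
  "sample n x y = (\<lambda>j\<in>{1..n}. (x j, y j))"

text \<open>An estimator for sample size \<open>n\<close> maps an evaluation point, a data set and a
  permutation to a real number.\<close>

type_synonym 'x estimator = "'x \<Rightarrow> (nat \<Rightarrow> 'x \<times> real) \<Rightarrow> (nat \<Rightarrow> nat) \<Rightarrow> real"

definition perm_stat ::
    "'x estimator \<Rightarrow> nat \<Rightarrow> (nat \<Rightarrow> 'x) \<Rightarrow> (nat \<Rightarrow> real) \<Rightarrow> (nat \<Rightarrow> nat) \<Rightarrow> real" where
  "perm_stat fhat n x y \<pi> = (\<Sum>i\<in>{1..n}. (fhat (x i) (sample n x y) \<pi>)\<^sup>2)"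

definition perm_pvalue :: "'x estimator \<Rightarrow> nat \<Rightarrow> (nat \<Rightarrow> 'x) \<Rightarrow> (nat \<Rightarrow> real) \<Rightarrow> real" where
  "perm_pvalue fhat n x y =
     (1 / real (card (perms n))) *
     (\<Sum>\<pi>\<in>perms n. of_bool (perm_stat fhat n x y id \<le> perm_stat fhat n x y \<pi>))"

text \<open>\<open>f_perm M S X Y \<pi> i\<close> is (a version of) the conditional expectation of \<open>Y (\<pi> i)\<close>
  given the \<open>S\<close>-valued random variable \<open>X i\<close>, as a function on the sample space.\<close>

definition f_perm ::
    "'b measure \<Rightarrow> 'x measure \<Rightarrow> (nat \<Rightarrow> 'b \<Rightarrow> 'x) \<Rightarrow> (nat \<Rightarrow> 'b \<Rightarrow> real) \<Rightarrow>
     (nat \<Rightarrow> nat) \<Rightarrow> nat \<Rightarrow> 'b \<Rightarrow> real" where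
  "f_perm M S X Y \<pi> i =
     real_cond_exp M (vimage_algebra (space M) (X i) S) (Y (\<pi> i))"

end

theory Submission
  imports Defs
begin

text \<open>
  Under the null hypothesis the permutation test is exact at every sample size, so the limsup
  only collects the bounds \<open>\<le> \<alpha>\<close> for the individual \<open>n > 0\<close>.

  If \<open>f\<close> vanishes, then \<open>y = \<epsilon>\<close> is independent of \<open>x\<close>. Hence all covariates and all responses of
  the sample are mutually independent, and permuting the responses by any fixed \<open>s\<close> leaves the
  law of the data unchanged (\<open>distr_regrouped_pairs\<close>). In particular the event that the p-value
  is at most \<open>\<alpha>\<close> has the same probability for \<open>(X, Y \<circ> s)\<close> as for \<open>(X, Y)\<close>.

  Now fix a data set \<open>(u, v)\<close>. By the equivariance of the estimator, the statistic at permutation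
  \<open>\<pi>\<close> and responses \<open>v \<circ> s\<close> is the unpermuted statistic at responses \<open>v \<circ> (s \<circ> \<pi>)\<close>. As
  \<open>s \<circ> \<pi>\<close> runs through the whole group, the p-value of \<open>(u, v \<circ> s)\<close> is
  the normalised rank, counted from above, of one number in a family indexed by the permutations;
  the family does not depend on \<open>s\<close> (\<open>perm_pvalue_permuted_responses\<close>). At most a
  fraction \<open>\<alpha>\<close> of the members of a finite family can have a normalised rank at most \<open>\<alpha>\<close>
  (\<open>card_low_rank_le\<close>); ties only enlarge the ranks. Taking expectations and averaging over \<open>s\<close>
  gives the bound for \<open>(X, Y)\<close> itself (\<open>prob_perm_pvalue_le\<close>).
\<close>

section \<open>Ranks in a finite family\<close>

text \<open>A low-ranked member \<open>m\<close> of smallest value has every low-ranked member among those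
  counted by its own rank, and that rank is at most \<open>c\<close>.\<close>

lemma card_low_rank_le:
  fixes t :: "'i \<Rightarrow> 'b :: linorder" and c :: real
  assumes "finite A" "0 \<le> c"
  shows "real (card {s \<in> A. real (card {r \<in> A. t s \<le> t r}) \<le> c}) \<le> c"
proof (cases "{s \<in> A. real (card {r \<in> A. t s \<le> t r}) \<le> c} = {}")
  case True
  show ?thesis unfolding True using assms by simp
next
  case False
  let ?L = "{s \<in> A. real (card {r \<in> A. t s \<le> t r}) \<le> c}"
  have "finite (t ` ?L)" "t ` ?L \<noteq> {}"
    using False assms by auto
  then have "Min (t ` ?L) \<in> t ` ?L" by (rule Min_in)
  then obtain m where m: "m \<in> ?L" "t m = Min (t ` ?L)" by auto
  have "?L \<subseteq> {r \<in> A. t m \<le> t r}"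
    using m(2) \<open>finite (t ` ?L)\<close> by auto
  then have "card ?L \<le> card {r \<in> A. t m \<le> t r}"
    using assms by (intro card_mono) auto
  then show ?thesis using m(1) by simp
qed

section \<open>Permuting independent coordinates\<close>

text \<open>Unlike \<open>indep_var_distribution_eq\<close>, this allows the two variables to take values in
  different types, as covariates and responses do.\<close>

lemma (in prob_space) distr_Pair_eq_pair_measure:
  assumes [measurable]: "X \<in> measurable M S" "Y \<in> measurable M T"
    and indep: "\<And>A B. A \<in> sets S \<Longrightarrow> B \<in> sets T \<Longrightarrow>
      prob ((X -` A \<inter> space M) \<inter> (Y -` B \<inter> space M)) =
        prob (X -` A \<inter> space M) * prob (Y -` B \<inter> space M)"
  shows "distr M (S \<Otimes>\<^sub>M T) (\<lambda>\<omega>. (X \<omega>, Y \<omega>)) = distr M S X \<Otimes>\<^sub>M distr M T Y"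
proof (rule pair_measure_eqI[symmetric])
  show "sigma_finite_measure (distr M S X)" "sigma_finite_measure (distr M T Y)"
    by (intro prob_space_imp_sigma_finite prob_space_distr; measurable)+
  show "sets (distr M S X \<Otimes>\<^sub>M distr M T Y) = sets (distr M (S \<Otimes>\<^sub>M T) (\<lambda>\<omega>. (X \<omega>, Y \<omega>)))"
    by simp
next
  fix A B assume "A \<in> sets (distr M S X)" "B \<in> sets (distr M T Y)"
  then have [measurable]: "A \<in> sets S" "B \<in> sets T" by auto
  have eq: "(\<lambda>\<omega>. (X \<omega>, Y \<omega>)) -` (A \<times> B) \<inter> space M
      = (X -` A \<inter> space M) \<inter> (Y -` B \<inter> space M)"
    by auto
  show "emeasure (distr M S X) A * emeasure (distr M T Y) B
      = emeasure (distr M (S \<Otimes>\<^sub>M T) (\<lambda>\<omega>. (X \<omega>, Y \<omega>))) (A \<times> B)"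
    by (simp add: emeasure_distr eq emeasure_eq_measure indep ennreal_mult')
qed

lemma Int_stable_vimages: "Int_stable {f -` A \<inter> \<Omega> | A. A \<in> sets N}"
proof (rule Int_stableI)
  fix a b assume "a \<in> {f -` A \<inter> \<Omega> | A. A \<in> sets N}" "b \<in> {f -` A \<inter> \<Omega> | A. A \<in> sets N}"
  then obtain A B where "A \<in> sets N" "B \<in> sets N" "a = f -` A \<inter> \<Omega>" "b = f -` B \<inter> \<Omega>"
    by blast
  then show "a \<inter> b \<in> {f -` A \<inter> \<Omega> | A. A \<in> sets N}"
    by (intro CollectI exI[of _ "A \<inter> B"]) auto
qed

text \<open>When the pairs are independent of each other and each has a product law, the \<open>X i\<close> and \<open>Y i\<close>
  are all mutually independent. This is expressed by a family of set systems indexed by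
  \<open>I \<times> bool\<close>, since the variables have different types. Any grouping of these
  systems into disjoint blocks is independent again, in particular the one that joins \<open>X i\<close>
  with \<open>Y (s i)\<close>. Common marginals then make the law independent of \<open>s\<close>.\<close>

lemma (in prob_space) distr_regrouped_pairs:
  fixes X :: "'i \<Rightarrow> 'a \<Rightarrow> 'x" and Y :: "'i \<Rightarrow> 'a \<Rightarrow> 'y"
  assumes I: "finite I" "I \<noteq> {}"
    and indep: "indep_vars (\<lambda>_. S \<Otimes>\<^sub>M T) (\<lambda>i \<omega>. (X i \<omega>, Y i \<omega>)) I"
    and DE: "prob_space D" "prob_space E"
    and law: "\<And>i. i \<in> I \<Longrightarrow> distr M (S \<Otimes>\<^sub>M T) (\<lambda>\<omega>. (X i \<omega>, Y i \<omega>)) = D \<Otimes>\<^sub>M E"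
    and DE_sets [measurable_cong]: "sets D = sets S" "sets E = sets T"
    and s: "inj_on s I" "s ` I \<subseteq> I"
  shows "distr M (\<Pi>\<^sub>M i\<in>I. S \<Otimes>\<^sub>M T) (\<lambda>\<omega>. \<lambda>i\<in>I. (X i \<omega>, Y (s i) \<omega>)) = (\<Pi>\<^sub>M i\<in>I. D \<Otimes>\<^sub>M E)"
proof -
  interpret D: prob_space D by fact
  interpret E: prob_space E by fact
  have XY: "(\<lambda>\<omega>. (X i \<omega>, Y i \<omega>)) \<in> measurable M (S \<Otimes>\<^sub>M T)" if "i \<in> I" for i
    using indep that by (auto simp: indep_vars_def2)
  have X: "X i \<in> measurable M S" if "i \<in> I" for i
    using measurable_compose[OF XY[OF that] measurable_fst] by simp
  have Y: "Y i \<in> measurable M T" if "i \<in> I" for i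
    using measurable_compose[OF XY[OF that] measurable_snd] by simp
  have space: "space D = space S" "space E = space T"
    using DE_sets by (auto dest: sets_eq_imp_space_eq)
  have box: "emeasure M ((X i -` A \<inter> space M) \<inter> (Y i -` B \<inter> space M)) = emeasure D A * emeasure E B"
    if "i \<in> I" "A \<in> sets S" "B \<in> sets T" for i A B
  proof -
    have "(X i -` A \<inter> space M) \<inter> (Y i -` B \<inter> space M)
        = (\<lambda>\<omega>. (X i \<omega>, Y i \<omega>)) -` (A \<times> B) \<inter> space M" by auto
    then have "emeasure M ((X i -` A \<inter> space M) \<inter> (Y i -` B \<inter> space M))
        = emeasure (distr M (S \<Otimes>\<^sub>M T) (\<lambda>\<omega>. (X i \<omega>, Y i \<omega>))) (A \<times> B)"
      using that XY by (simp add: emeasure_distr)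
    also have "\<dots> = emeasure D A * emeasure E B"
      using that by (simp add: law DE_sets E.emeasure_pair_measure_Times)
    finally show ?thesis .
  qed
  have pX: "emeasure M (X i -` A \<inter> space M) = emeasure D A" if "i \<in> I" "A \<in> sets S" for i A
  proof -
    have "Y i -` space T \<inter> space M = space M" using measurable_space[OF Y[OF that(1)]] by auto
    then show ?thesis
      using box[OF that, of "space T"] E.emeasure_space_1 by (simp add: space Int_assoc)
  qed
  have pY: "emeasure M (Y i -` B \<inter> space M) = emeasure E B" if "i \<in> I" "B \<in> sets T" for i B
  proof -
    have "X i -` space S \<inter> space M = space M" using measurable_space[OF X[OF that(1)]] by auto
    then show ?thesis
      using box[OF that(1) sets.top that(2)] D.emeasure_space_1 by (simp add: space Int_assoc Int_absorb1)
  qed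
  have box': "prob ((X i -` A \<inter> space M) \<inter> (Y i -` B \<inter> space M))
      = prob (X i -` A \<inter> space M) * prob (Y i -` B \<inter> space M)"
    if "i \<in> I" "A \<in> sets S" "B \<in> sets T" for i A B
    using box[OF that] pX[OF that(1,2)] pY[OF that(1,3)]
    by (simp add: measure_def enn2real_mult)

  define F where "F = (\<lambda>(i, b). if b then {X i -` A \<inter> space M | A. A \<in> sets S}
                               else {Y i -` B \<inter> space M | B. B \<in> sets T})"
  have F_events: "F k \<subseteq> events" if "k \<in> I \<times> UNIV" for k
    using that X Y by (auto simp: F_def intro: measurable_sets split: if_splits)
  have indep_F: "indep_sets F (I \<times> UNIV)"
  proof (subst indep_sets_finite)
    show "I \<times> (UNIV :: bool set) \<noteq> {}" "finite (I \<times> (UNIV :: bool set))" using I by auto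
    show "space M \<in> F k" if "k \<in> I \<times> UNIV" for k
    proof -
      obtain i b where k: "k = (i, b)" by (cases k)
      with that have "space M = X i -` space S \<inter> space M" "space M = Y i -` space T \<inter> space M"
        using measurable_space[OF X] measurable_space[OF Y] by auto
      then have "space M \<in> {X i -` A \<inter> space M | A. A \<in> sets S}"
          "space M \<in> {Y i -` B \<inter> space M | B. B \<in> sets T}"
        using sets.top by blast+
      then show ?thesis by (simp only: F_def k prod.case split: if_split) simp
    qed
    show "\<forall>A\<in>Pi (I \<times> UNIV) F. prob (\<Inter>k\<in>I \<times> UNIV. A k) = (\<Prod>k\<in>I \<times> UNIV. prob (A k))"
    proof
      fix A assume A: "A \<in> Pi (I \<times> UNIV) F"
      have "\<forall>i\<in>I. A (i, True) \<in> F (i, True)" using A by auto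
      then have "\<forall>i\<in>I. \<exists>U. U \<in> sets S \<and> A (i, True) = X i -` U \<inter> space M"
        by (simp add: F_def) blast
      then obtain U where U: "\<And>i. i \<in> I \<Longrightarrow> U i \<in> sets S"
          "\<And>i. i \<in> I \<Longrightarrow> A (i, True) = X i -` U i \<inter> space M" by metis
      have "\<forall>i\<in>I. A (i, False) \<in> F (i, False)" using A by auto
      then have "\<forall>i\<in>I. \<exists>V. V \<in> sets T \<and> A (i, False) = Y i -` V \<inter> space M"
        by (simp add: F_def) blast
      then obtain V where V: "\<And>i. i \<in> I \<Longrightarrow> V i \<in> sets T"
          "\<And>i. i \<in> I \<Longrightarrow> A (i, False) = Y i -` V i \<inter> space M" by metis
      have "(\<Inter>k\<in>I \<times> UNIV. A k) = (\<Inter>i\<in>I. A (i, True) \<inter> A (i, False))"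
        by (auto simp: UNIV_bool)
      also have "\<dots> = (\<Inter>i\<in>I. (\<lambda>\<omega>. (X i \<omega>, Y i \<omega>)) -` (U i \<times> V i) \<inter> space M)"
        using U V by (intro INF_cong) auto
      finally have "prob (\<Inter>k\<in>I \<times> UNIV. A k)
          = (\<Prod>i\<in>I. prob ((\<lambda>\<omega>. (X i \<omega>, Y i \<omega>)) -` (U i \<times> V i) \<inter> space M))"
        using indep_varsD_finite[OF indep I(2,1), of "\<lambda>i. U i \<times> V i"] U V by simp
      also have "\<dots> = (\<Prod>i\<in>I. prob (A (i, True) \<inter> A (i, False)))"
        using U V by (intro prod.cong refl arg_cong[of _ _ prob]) auto
      also have "\<dots> = (\<Prod>i\<in>I. prob (A (i, True)) * prob (A (i, False)))"
        using box' U V by (intro prod.cong) auto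
      also have "\<dots> = (\<Prod>i\<in>I. \<Prod>b\<in>UNIV. prob (A (i, b)))"
        by (simp add: UNIV_bool mult.commute)
      also have "\<dots> = (\<Prod>k\<in>I \<times> UNIV. prob (A k))"
        by (simp add: prod.cartesian_product)
      finally show "prob (\<Inter>k\<in>I \<times> UNIV. A k) = (\<Prod>k\<in>I \<times> UNIV. prob (A k))" .
    qed
  qed (use F_events in auto)

  define L where "L = (\<lambda>j. {(j, True), (s j, False)})"
  have "indep_sets (\<lambda>j. sigma_sets (space M) (\<Union>k\<in>L j. F k)) I"
  proof (rule indep_sets_collect_sigma)
    show "indep_sets F (\<Union>j\<in>I. L j)"
      by (rule indep_sets_mono_index[OF _ indep_F]) (use s in \<open>auto simp: L_def\<close>)
    show "disjoint_family_on L I"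
      using s by (auto simp: disjoint_family_on_def L_def inj_on_def)
    show "Int_stable (F k)" for k
      by (cases k) (simp add: F_def Int_stable_vimages)
  qed
  then have regrouped: "indep_vars (\<lambda>_. S \<Otimes>\<^sub>M T) (\<lambda>i \<omega>. (X i \<omega>, Y (s i) \<omega>)) I"
    unfolding indep_vars_def2
  proof (intro conjI ballI)
    fix i assume "i \<in> I"
    then show "(\<lambda>\<omega>. (X i \<omega>, Y (s i) \<omega>)) \<in> measurable M (S \<Otimes>\<^sub>M T)"
      using X Y s by (intro measurable_Pair) auto
  next
    assume ind: "indep_sets (\<lambda>j. sigma_sets (space M) (\<Union>k\<in>L j. F k)) I"
    show "indep_sets (\<lambda>i. {(\<lambda>\<omega>. (X i \<omega>, Y (s i) \<omega>)) -` A \<inter> space M |A. A \<in> sets (S \<Otimes>\<^sub>M T)}) I"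
    proof (rule indep_sets_mono_sets[OF ind])
      fix i assume i: "i \<in> I"
      let ?N = "sigma (space M) (\<Union>k\<in>L i. F k)"
      have sub: "(\<Union>k\<in>L i. F k) \<subseteq> Pow (space M)"
        by (auto simp: F_def L_def split: if_splits)
      have "X i \<in> measurable ?N S"
      proof (rule measurableI)
        show "X i \<omega> \<in> space S" if "\<omega> \<in> space ?N" for \<omega>
          using that measurable_space[OF X[OF i]] sub by (simp add: space_measure_of)
        show "X i -` A \<inter> space ?N \<in> sets ?N" if "A \<in> sets S" for A
          using that sub by (auto simp: space_measure_of sets_measure_of L_def F_def)
      qed
      moreover have "Y (s i) \<in> measurable ?N T"
      proof (rule measurableI)
        show "Y (s i) \<omega> \<in> space T" if "\<omega> \<in> space ?N" for \<omega>
          using that measurable_space[OF Y, of "s i"] s i sub by (auto simp: space_measure_of)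
        show "Y (s i) -` A \<inter> space ?N \<in> sets ?N" if "A \<in> sets T" for A
          using that sub by (auto simp: space_measure_of sets_measure_of L_def F_def)
      qed
      ultimately have "(\<lambda>\<omega>. (X i \<omega>, Y (s i) \<omega>)) \<in> measurable ?N (S \<Otimes>\<^sub>M T)"
        by (rule measurable_Pair)
      from measurable_sets[OF this]
      show "{(\<lambda>\<omega>. (X i \<omega>, Y (s i) \<omega>)) -` A \<inter> space M |A. A \<in> sets (S \<Otimes>\<^sub>M T)}
          \<subseteq> sigma_sets (space M) (\<Union>k\<in>L i. F k)"
        using sub by (auto simp: space_measure_of sets_measure_of)
    qed
  qed

  have marginal: "distr M (S \<Otimes>\<^sub>M T) (\<lambda>\<omega>. (X i \<omega>, Y (s i) \<omega>)) = D \<Otimes>\<^sub>M E" if i: "i \<in> I" for i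
  proof -
    have si: "s i \<in> I" using s i by auto
    have "distr M (S \<Otimes>\<^sub>M T) (\<lambda>\<omega>. (X i \<omega>, Y (s i) \<omega>)) = distr M S (X i) \<Otimes>\<^sub>M distr M T (Y (s i))"
    proof (rule distr_Pair_eq_pair_measure[OF X[OF i] Y[OF si]])
      fix A B assume AB: "A \<in> sets S" "B \<in> sets T"
      let ?A = "\<lambda>(j, b). if b then X i -` A \<inter> space M else Y (s i) -` B \<inter> space M"
      have "prob (\<Inter>k\<in>L i. ?A k) = (\<Prod>k\<in>L i. prob (?A k))"
        using i si AB by (intro indep_setsD[OF indep_F]) (auto simp: L_def F_def)
      then show "prob ((X i -` A \<inter> space M) \<inter> (Y (s i) -` B \<inter> space M))
          = prob (X i -` A \<inter> space M) * prob (Y (s i) -` B \<inter> space M)"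
        by (simp add: L_def)
    qed
    also have "distr M S (X i) = D"
      using pX[OF i] X[OF i] by (intro measure_eqI) (auto simp: DE_sets emeasure_distr)
    also have "distr M T (Y (s i)) = E"
      using pY[OF si] Y[OF si] by (intro measure_eqI) (auto simp: DE_sets emeasure_distr)
    finally show ?thesis .
  qed
  have "distr M (\<Pi>\<^sub>M i\<in>I. S \<Otimes>\<^sub>M T) (\<lambda>\<omega>. \<lambda>i\<in>I. (X i \<omega>, Y (s i) \<omega>))
      = (\<Pi>\<^sub>M i\<in>I. distr M (S \<Otimes>\<^sub>M T) (\<lambda>\<omega>. (X i \<omega>, Y (s i) \<omega>)))"
    using regrouped I X Y s
    by (subst indep_vars_iff_distr_eq_PiM'[symmetric]) (auto intro!: measurable_Pair)
  also have "\<dots> = (\<Pi>\<^sub>M i\<in>I. D \<Otimes>\<^sub>M E)"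
    using marginal by (intro PiM_cong) auto
  finally show ?thesis .
qed

section \<open>The permutation p-value as a rank\<close>

lemma finite_perms: "finite (perms n)"
  by (simp add: perms_def finite_permutations)

lemma card_perms_pos: "0 < card (perms n)"
  by (simp add: perms_def card_permutations[of _ n])

lemma perm_stat_cong:
  assumes "\<And>i. i \<in> {1..n} \<Longrightarrow> u i = u' i" "\<And>i. i \<in> {1..n} \<Longrightarrow> v i = v' i"
  shows "perm_stat g n u v \<pi> = perm_stat g n u' v' \<pi>"
proof -
  have "sample n u v = sample n u' v'"
    using assms by (auto simp: sample_def)
  then show ?thesis using assms by (auto simp: perm_stat_def)
qed

lemma perm_pvalue_cong:
  assumes "\<And>i. i \<in> {1..n} \<Longrightarrow> u i = u' i" "\<And>i. i \<in> {1..n} \<Longrightarrow> v i = v' i"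
  shows "perm_pvalue g n u v = perm_pvalue g n u' v'"
proof -
  have "perm_stat g n u v = perm_stat g n u' v'"
    by (intro ext perm_stat_cong assms)
  then show ?thesis by (simp add: perm_pvalue_def)
qed

text \<open>Left translation by \<open>s\<close> is a bijection of the permutation group; it turns the comparison
  over \<open>\<pi>\<close> into one over \<open>r = s \<circ> \<pi>\<close>, in which \<open>s\<close> only selects the member to be ranked.\<close>

lemma perm_pvalue_permuted_responses:
  assumes equivariant: "\<And>\<pi> v. \<pi> \<in> perms n \<Longrightarrow> perm_stat g n u v \<pi> = perm_stat g n u (v \<circ> \<pi>) id"
    and s: "s \<in> perms n"
  shows "perm_pvalue g n u (v \<circ> s) =
    real (card {r \<in> perms n. perm_stat g n u (v \<circ> s) id \<le> perm_stat g n u (v \<circ> r) id}) / real (card (perms n))"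
proof -
  let ?T = "\<lambda>r. perm_stat g n u (v \<circ> r) id"
  have "(\<Sum>\<pi>\<in>perms n. of_bool (perm_stat g n u (v \<circ> s) id \<le> perm_stat g n u (v \<circ> s) \<pi>))
      = (\<Sum>\<pi>\<in>perms n. of_bool (?T s \<le> ?T (s \<circ> \<pi>)) :: real)"
    by (intro sum.cong refl) (simp add: equivariant[of _ "v \<circ> s"] comp_assoc)
  also have "\<dots> = (\<Sum>r\<in>perms n. of_bool (?T s \<le> ?T r))"
    using s unfolding perms_def mem_Collect_eq by (rule setum_permutations_compose_left[symmetric])
  also have "\<dots> = real (card {r \<in> perms n. ?T s \<le> ?T r})"
    using finite_perms[of n] by (simp add: of_bool_def sum.If_cases Int_def)
  finally show ?thesis by (simp add: perm_pvalue_def)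
qed

lemma card_small_pvalue_le:
  assumes equivariant: "\<And>\<pi> v. \<pi> \<in> perms n \<Longrightarrow> perm_stat g n u v \<pi> = perm_stat g n u (v \<circ> \<pi>) id"
    and "0 \<le> \<alpha>"
  shows "real (card {s \<in> perms n. perm_pvalue g n u (v \<circ> s) \<le> \<alpha>}) \<le> \<alpha> * real (card (perms n))"
proof -
  have "{s \<in> perms n. perm_pvalue g n u (v \<circ> s) \<le> \<alpha>} =
    {s \<in> perms n. real (card {r \<in> perms n. perm_stat g n u (v \<circ> s) id \<le> perm_stat g n u (v \<circ> r) id})
      \<le> \<alpha> * real (card (perms n))}"
    using perm_pvalue_permuted_responses[of n g u, OF equivariant] card_perms_pos[of n]
    by (auto simp: divide_le_eq)
  then show ?thesis
    using card_low_rank_le[OF finite_perms, of "\<alpha> * real (card (perms n))" n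
        "\<lambda>s. perm_stat g n u (v \<circ> s) id"] assms by simp
qed

lemma measurable_perm_pvalue:
  assumes "\<And>\<pi>. \<pi> \<in> perms n \<Longrightarrow>
    (\<lambda>(u, d). g u d \<pi>) \<in> borel_measurable (S \<Otimes>\<^sub>M (\<Pi>\<^sub>M j\<in>{1..n}. S \<Otimes>\<^sub>M borel))"
  shows "(\<lambda>d. perm_pvalue g n (\<lambda>j. fst (d j)) (\<lambda>j. snd (d j)))
    \<in> borel_measurable (\<Pi>\<^sub>M j\<in>{1..n}. S \<Otimes>\<^sub>M borel)"
proof -
  let ?N = "\<Pi>\<^sub>M j\<in>{1..n}. S \<Otimes>\<^sub>M (borel :: real measure)"
  have stat [measurable]: "(\<lambda>d. perm_stat g n (\<lambda>j. fst (d j)) (\<lambda>j. snd (d j)) \<pi>) \<in> borel_measurable ?N"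
    if \<pi>: "\<pi> \<in> perms n" for \<pi>
  proof -
    have sample: "sample n (\<lambda>j. fst (d j)) (\<lambda>j. snd (d j)) = d" if "d \<in> space ?N" for d
      using that by (auto simp: sample_def space_PiM PiE_def extensional_def)
    have "(\<lambda>d. \<Sum>i\<in>{1..n}. (g (fst (d i)) d \<pi>)\<^sup>2) \<in> borel_measurable ?N"
    proof (intro borel_measurable_sum borel_measurable_power)
      fix i assume "i \<in> {1..n}"
      then have "(\<lambda>d. (fst (d i), d)) \<in> measurable ?N (S \<Otimes>\<^sub>M ?N)"
        by measurable
      from measurable_compose[OF this assms[OF \<pi>]]
      show "(\<lambda>d. g (fst (d i)) d \<pi>) \<in> borel_measurable ?N" by simp
    qed
    then show ?thesis
      by (rule measurable_cong[THEN iffD1, rotated]) (simp add: perm_stat_def sample)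
  qed
  have id: "id \<in> perms n" by (simp add: perms_def permutes_id)
  show ?thesis
    unfolding perm_pvalue_def of_bool_def
    using stat id
    by (intro borel_measurable_times borel_measurable_const borel_measurable_sum measurable_If) auto
qed

section \<open>Exactness of the permutation test\<close>

text \<open>The double count behind randomisation tests: \<open>card A * p\<close> is the expected number of the
  events \<open>E s\<close> that occur.\<close>

lemma (in prob_space) prob_le_average_bound:
  assumes "finite A" "A \<noteq> {}"
    and ev: "\<And>s. s \<in> A \<Longrightarrow> E s \<in> events"
    and const: "\<And>s. s \<in> A \<Longrightarrow> prob (E s) = p"
    and count: "\<And>\<omega>. \<omega> \<in> space M \<Longrightarrow> real (card {s \<in> A. \<omega> \<in> E s}) \<le> c * real (card A)"
  shows "p \<le> c"
proof -
  have "real (card A) * p = (\<Sum>s\<in>A. prob (E s))" using const by simp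
  also have "\<dots> = (\<Sum>s\<in>A. expectation (indicator (E s)))"
    using ev by (intro sum.cong) auto
  also have "\<dots> = expectation (\<lambda>\<omega>. \<Sum>s\<in>A. indicator (E s) \<omega>)"
    using ev by (subst Bochner_Integration.integral_sum) (auto intro!: finite_measure.integrable_const_bound[where B=1])
  also have "\<dots> \<le> expectation (\<lambda>_. c * real (card A))"
  proof (rule integral_mono)
    show "integrable M (\<lambda>\<omega>. \<Sum>s\<in>A. indicator (E s) \<omega> :: real)"
      using ev by (auto simp: emeasure_eq_measure)
    fix \<omega> assume \<omega>: "\<omega> \<in> space M"
    have "(\<Sum>s\<in>A. indicator (E s) \<omega> :: real) = real (card {s \<in> A. \<omega> \<in> E s})"
      using assms(1) by (simp add: indicator_def of_bool_def sum.If_cases Int_def)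
    then show "(\<Sum>s\<in>A. indicator (E s) \<omega>) \<le> c * real (card A)" using count[OF \<omega>] by simp
  qed simp
  also have "\<dots> = real (card A) * c" by (simp add: prob_space)
  finally show ?thesis using assms(1,2) by (simp add: card_gt_0_iff)
qed

text \<open>The events \<open>A s\<close>, that the test rejects after the responses are permuted by \<open>s\<close>, are
  equally likely because each is the preimage of one set of data sets \<open>B\<close> under a random data
  set whose law does not involve \<open>s\<close>. Pointwise, at most a fraction \<open>\<alpha>\<close> of them occur.\<close>

lemma (in prob_space) prob_perm_pvalue_le:
  fixes X :: "nat \<Rightarrow> 'a \<Rightarrow> 'x" and Y :: "nat \<Rightarrow> 'a \<Rightarrow> real"
  assumes n: "0 < n"
    and indep: "indep_vars (\<lambda>_. S \<Otimes>\<^sub>M borel) (\<lambda>i \<omega>. (X i \<omega>, Y i \<omega>)) {1..n}"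
    and DE: "prob_space D" "prob_space E" "sets D = sets S" "sets E = sets borel"
    and law: "\<And>i. i \<in> {1..n} \<Longrightarrow> distr M (S \<Otimes>\<^sub>M borel) (\<lambda>\<omega>. (X i \<omega>, Y i \<omega>)) = D \<Otimes>\<^sub>M E"
    and meas: "\<And>\<pi>. \<pi> \<in> perms n \<Longrightarrow>
      (\<lambda>(u, d). g u d \<pi>) \<in> borel_measurable (S \<Otimes>\<^sub>M (\<Pi>\<^sub>M j\<in>{1..n}. S \<Otimes>\<^sub>M borel))"
    and equivariant: "\<And>\<pi> u v i. \<pi> \<in> perms n \<Longrightarrow> u \<in> {1..n} \<rightarrow> space S \<Longrightarrow> i \<in> {1..n} \<Longrightarrow>
      g (u i) (sample n u v) \<pi> = g (u i) (sample n u (v \<circ> \<pi>)) id"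
    and "0 \<le> \<alpha>"
  shows "prob {\<omega> \<in> space M. perm_pvalue g n (\<lambda>j. X j \<omega>) (\<lambda>j. Y j \<omega>) \<le> \<alpha>} \<le> \<alpha>"
proof -
  let ?N = "\<Pi>\<^sub>M j\<in>{1..n}. S \<Otimes>\<^sub>M (borel :: real measure)"
  define h where "h d = perm_pvalue g n (\<lambda>j. fst (d j)) (\<lambda>j. snd (d j))" for d
  define B where "B = {d \<in> space ?N. h d \<le> \<alpha>}"
  define Z where "Z s \<omega> = (\<lambda>i\<in>{1..n}. (X i \<omega>, Y (s i) \<omega>))" for s \<omega>
  define A where "A s = {\<omega> \<in> space M. perm_pvalue g n (\<lambda>j. X j \<omega>) ((\<lambda>j. Y j \<omega>) \<circ> s) \<le> \<alpha>}" for s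
  have XY: "(\<lambda>\<omega>. (X i \<omega>, Y i \<omega>)) \<in> measurable M (S \<Otimes>\<^sub>M borel)" if "i \<in> {1..n}" for i
    using indep that by (auto simp: indep_vars_def2)
  have X: "X i \<in> measurable M S" if "i \<in> {1..n}" for i
    using measurable_compose[OF XY[OF that] measurable_fst] by simp
  have Y: "Y i \<in> borel_measurable M" if "i \<in> {1..n}" for i
    using measurable_compose[OF XY[OF that] measurable_snd] by simp
  have B: "B \<in> sets ?N"
    using measurable_perm_pvalue[of n g S, OF meas] unfolding B_def h_def by measurable
  have perm_image: "s i \<in> {1..n}" if "s \<in> perms n" "i \<in> {1..n}" for s i
    using that permutes_in_image[of s "{1..n}" i] by (simp add: perms_def)
  have Z: "Z s \<in> measurable M ?N" if "s \<in> perms n" for s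
    unfolding Z_def using X Y perm_image[OF that]
    by (intro measurable_restrict measurable_Pair) auto
  have hZ: "h (Z s \<omega>) = perm_pvalue g n (\<lambda>j. X j \<omega>) ((\<lambda>j. Y j \<omega>) \<circ> s)" for s \<omega>
    unfolding h_def Z_def by (rule perm_pvalue_cong) auto
  have A_eq: "A s = Z s -` B \<inter> space M" if "s \<in> perms n" for s
    using measurable_space[OF Z[OF that]] by (auto simp: A_def B_def hZ)
  have A_prob: "prob (A s) = measure (\<Pi>\<^sub>M i\<in>{1..n}. D \<Otimes>\<^sub>M E) B" if s: "s \<in> perms n" for s
  proof -
    have "distr M ?N (Z s) = (\<Pi>\<^sub>M i\<in>{1..n}. D \<Otimes>\<^sub>M E)"
      unfolding Z_def
    proof (rule distr_regrouped_pairs[OF _ _ indep DE(1,2) law DE(3,4)])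
      have "s permutes {1..n}" using s by (simp add: perms_def)
      then show "inj_on s {1..n}" "s ` {1..n} \<subseteq> {1..n}"
        by (simp_all add: permutes_inj_on permutes_image)
    qed (use n in auto)
    then show ?thesis
      using measure_distr[OF Z[OF s] B] by (simp add: A_eq[OF s])
  qed
  have id: "id \<in> perms n" by (simp add: perms_def permutes_id)
  have "prob (A id) \<le> \<alpha>"
  proof (rule prob_le_average_bound[of "perms n" A])
    show "finite (perms n)" "perms n \<noteq> {}" using finite_perms id by auto
    show "A s \<in> events" if "s \<in> perms n" for s
      using measurable_sets[OF Z[OF that] B] by (simp add: A_eq[OF that])
    show "prob (A s) = prob (A id)" if "s \<in> perms n" for s
      using A_prob[OF that] A_prob[OF id] by simp
    show "real (card {s \<in> perms n. \<omega> \<in> A s}) \<le> \<alpha> * real (card (perms n))"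
      if \<omega>: "\<omega> \<in> space M" for \<omega>
    proof -
      have "(\<lambda>j. X j \<omega>) \<in> {1..n} \<rightarrow> space S" using measurable_space[OF X \<omega>] by auto
      then have "perm_stat g n (\<lambda>j. X j \<omega>) v \<pi> = perm_stat g n (\<lambda>j. X j \<omega>) (v \<circ> \<pi>) id"
        if "\<pi> \<in> perms n" for \<pi> v
        unfolding perm_stat_def
        using equivariant[OF that] by (intro sum.cong arg_cong[of _ _ "\<lambda>t. t\<^sup>2"]) auto
      from card_small_pvalue_le[of n g, OF this \<open>0 \<le> \<alpha>\<close>]
      show ?thesis using \<omega> by (simp add: A_def)
    qed
  qed
  then show ?thesis by (simp add: A_def)
qed

theorem theorem3:
  fixes \<alpha> \<delta> \<sigma>\<^sub>\<mu> \<sigma>\<^sub>\<epsilon> :: real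
    and P :: "'a measure" and S :: "'x measure"
    and x :: "'a \<Rightarrow> 'x" and y \<epsilon> :: "'a \<Rightarrow> real" and f :: "'x \<Rightarrow> real"
    and M :: "nat \<Rightarrow> 'b measure"
    and X :: "nat \<Rightarrow> nat \<Rightarrow> 'b \<Rightarrow> 'x" and Y :: "nat \<Rightarrow> nat \<Rightarrow> 'b \<Rightarrow> real"
    and fhat :: "nat \<Rightarrow> 'x estimator" and l :: "nat \<Rightarrow> real"
  assumes alpha: "0 < \<alpha>" "\<alpha> < 1"
    and P: "prob_space P"
    and x: "x \<in> measurable P S"
    and f: "f \<in> borel_measurable S"
    and eps: "\<epsilon> \<in> borel_measurable P"
    and y: "\<And>\<omega>. \<omega> \<in> space P \<Longrightarrow> y \<omega> = f (x \<omega>) + \<epsilon> \<omega>"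
    and f_mean: "integrable P (\<lambda>\<omega>. f (x \<omega>))" "(\<integral>\<omega>. f (x \<omega>) \<partial>P) = 0"
    and f_var: "integrable P (\<lambda>\<omega>. (f (x \<omega>))^2)" "(\<integral>\<omega>. (f (x \<omega>))^2 \<partial>P) = \<sigma>\<^sub>\<mu>^2"
    and f_fourth: "integrable P (\<lambda>\<omega>. (f (x \<omega>))^4)"
    and eps_mean: "integrable P \<epsilon>" "(\<integral>\<omega>. \<epsilon> \<omega> \<partial>P) = 0"
    and eps_var: "integrable P (\<lambda>\<omega>. (\<epsilon> \<omega>)^2)" "(\<integral>\<omega>. (\<epsilon> \<omega>)^2 \<partial>P) = \<sigma>\<^sub>\<epsilon>^2"
    and eps_indep: "prob_space.indep_set P
          (sets (vimage_algebra (space P) \<epsilon> borel)) (sets (vimage_algebra (space P) x S))"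
    and M: "\<And>n. prob_space (M n)"
    and copies_indep: "\<And>n. prob_space.indep_vars (M n) (\<lambda>_. S \<Otimes>\<^sub>M borel)
          (\<lambda>i \<omega>. (X n i \<omega>, Y n i \<omega>)) {1..n}"
    and copies_distr: "\<And>n i. i \<in> {1..n} \<Longrightarrow>
          distr (M n) (S \<Otimes>\<^sub>M borel) (\<lambda>\<omega>. (X n i \<omega>, Y n i \<omega>)) =
          distr P (S \<Otimes>\<^sub>M borel) (\<lambda>\<omega>. (x \<omega>, y \<omega>))"
    and delta: "\<delta> > 0"
    and fhat_measurable: "\<And>n \<pi>. \<pi> \<in> perms n \<Longrightarrow>
          (\<lambda>(u, d). fhat n u d \<pi>) \<in>
            borel_measurable (S \<Otimes>\<^sub>M (\<Pi>\<^sub>M j\<in>{1..n}. S \<Otimes>\<^sub>M borel))"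
    and fhat_perm: "\<And>n \<pi> u v i. \<pi> \<in> perms n \<Longrightarrow> u \<in> {1..n} \<rightarrow> space S \<Longrightarrow> i \<in> {1..n} \<Longrightarrow>
          fhat n (u i) (sample n u v) \<pi> = fhat n (u i) (sample n u (v \<circ> \<pi>)) id"
    and fhat_approx: "\<forall>\<^sub>F n in sequentially.
          (MIN \<pi>\<in>few_cycle_perms n \<union> {id}.
             measure (M n) {\<omega> \<in> space (M n).
               (\<Sum>i\<in>{1..n}. (fhat n (X n i \<omega>) (sample n (\<lambda>j. X n j \<omega>) (\<lambda>j. Y n j \<omega>)) \<pi>
                   - f_perm (M n) S (X n) (Y n) \<pi> i \<omega>)^2) \<le> l n}) \<ge> 1 - \<delta>"
  shows "(\<forall>u\<in>space S. f u = 0) \<longrightarrow>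
         limsup (\<lambda>n. ereal (measure (M n) {\<omega> \<in> space (M n).
           perm_pvalue (fhat n) n (\<lambda>j. X n j \<omega>) (\<lambda>j. Y n j \<omega>) \<le> \<alpha>})) \<le> ereal \<alpha>"
proof
  assume null: "\<forall>u\<in>space S. f u = 0"
  interpret P: prob_space P by (rule P)
  have y_eps: "y \<omega> = \<epsilon> \<omega>" if "\<omega> \<in> space P" for \<omega>
    using y[OF that] null measurable_space[OF x that] by simp
  have "distr P (S \<Otimes>\<^sub>M borel) (\<lambda>\<omega>. (x \<omega>, y \<omega>)) = distr P (S \<Otimes>\<^sub>M borel) (\<lambda>\<omega>. (x \<omega>, \<epsilon> \<omega>))"
    using y_eps by (intro distr_cong) auto
  also have "\<dots> = distr P S x \<Otimes>\<^sub>M distr P borel \<epsilon>"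
  proof (rule P.distr_Pair_eq_pair_measure[OF x eps])
    fix A B assume "A \<in> sets S" "B \<in> sets (borel :: real measure)"
    then have "\<epsilon> -` B \<inter> space P \<in> sets (vimage_algebra (space P) \<epsilon> borel)"
        "x -` A \<inter> space P \<in> sets (vimage_algebra (space P) x S)"
      by (auto intro: in_vimage_algebra)
    from P.indep_setD[OF eps_indep this]
    show "P.prob ((x -` A \<inter> space P) \<inter> (\<epsilon> -` B \<inter> space P))
        = P.prob (x -` A \<inter> space P) * P.prob (\<epsilon> -` B \<inter> space P)"
      by (simp add: Int_commute mult.commute)
  qed
  finally have law: "distr P (S \<Otimes>\<^sub>M borel) (\<lambda>\<omega>. (x \<omega>, y \<omega>)) = distr P S x \<Otimes>\<^sub>M distr P borel \<epsilon>" .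
  have bound: "measure (M n) {\<omega> \<in> space (M n).
      perm_pvalue (fhat n) n (\<lambda>j. X n j \<omega>) (\<lambda>j. Y n j \<omega>) \<le> \<alpha>} \<le> \<alpha>" if "0 < n" for n
    by (rule prob_space.prob_perm_pvalue_le[OF M that copies_indep P.prob_space_distr[OF x]
          P.prob_space_distr[OF eps] _ _ _ fhat_measurable fhat_perm])
      (use copies_distr law alpha in auto)
  show "limsup (\<lambda>n. ereal (measure (M n) {\<omega> \<in> space (M n).
      perm_pvalue (fhat n) n (\<lambda>j. X n j \<omega>) (\<lambda>j. Y n j \<omega>) \<le> \<alpha>})) \<le> ereal \<alpha>"
    by (rule Limsup_bounded, rule eventually_mono[OF eventually_gt_at_top[of 0]])
      (use bound in simp)
qed

end
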